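(* Let $G$ be a graph without loops. The R-cocore of $G$ is unique up to isomorphism; that is, any two R-cocores of $G$ are isomorphic graphs.
   Context: Graphs are finite and undirected: $G=(V_G,E_G)$ with $E_G\subseteq V_G\times V_G$ symmetric. For a graph $G$, a finite set $B$ and a relation $R\subseteq V_G\times B$ with full image (for every $b\in B$ there is $v\in V_G$ with $(v,b)\in R$), $G\ast R$ is the graph with vertex set $B$ and edge set $\{(u,v)\in B\times B : \text{there is } (x,y)\in E_G \text{ with } (x,u),(y,v)\in R\}$. The equation $H\ast R=G$ means that $R\subseteq V_H\times V_G$ has full image and $H\ast R$ equals $G$ as a graph. Let $H$ be an induced subgraph of $G$. An R-coretraction of $H$ to $G$ is a relation $R\subseteq V_H\times V_G$ such that $H\ast R=G$ and $(x,x)\in R$ for all $x\in V_H$; if one exists, $H$ is called an R-coretract of $G$. An R-coretract $H$ of $G$ is an R-cocore of $G$ if $H$ has no proper induced subgraph that is an R-coretract of $H$. *)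

theory Defs
  imports "Graph_Theory.Graph_Theory"
begin

text \<open>
  A graph is an \<open>'a pair_pre_digraph\<close> with finite vertex set \<open>pverts\<close> and symmetric edge
  relation \<open>parcs\<close>: the locale predicate \<open>pair_pseudo_graph\<close> if loops are allowed, and
  \<open>pair_graph\<close> for graphs without loops. As in the library, the null graph is included.
\<close>

definition full_image :: "'a set \<Rightarrow> 'b set \<Rightarrow> ('a \<times> 'b) set \<Rightarrow> bool" where
  "full_image V B R \<longleftrightarrow> R \<subseteq> V \<times> B \<and> (\<forall>b\<in>B. \<exists>v\<in>V. (v, b) \<in> R)"

text \<open>
  The graph \<open>G * R\<close>. The target set \<open>B\<close> is passed explicitly, since a relation given as a
  set of pairs does not determine its codomain.
\<close>

definition star :: "'a pair_pre_digraph \<Rightarrow> 'b set \<Rightarrow> ('a \<times> 'b) set \<Rightarrow> 'b pair_pre_digraph" where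
  "star G B R =
     \<lparr>pverts = B,
      parcs = {(u, v). u \<in> B \<and> v \<in> B \<and> (\<exists>x y. (x, y) \<in> parcs G \<and> (x, u) \<in> R \<and> (y, v) \<in> R)}\<rparr>"

text \<open>The equation \<open>H * R = G\<close>, including the side conditions on \<open>R\<close>.\<close>

definition star_eq :: "'a pair_pre_digraph \<Rightarrow> ('a \<times> 'b) set \<Rightarrow> 'b pair_pre_digraph \<Rightarrow> bool" where
  "star_eq H R G \<longleftrightarrow> full_image (pverts H) (pverts G) R \<and> star H (pverts G) R = G"

definition R_coretraction ::
    "'a pair_pre_digraph \<Rightarrow> 'a pair_pre_digraph \<Rightarrow> ('a \<times> 'a) set \<Rightarrow> bool" where
  "R_coretraction H G R \<longleftrightarrow>
     induced_subgraph (with_proj H) (with_proj G) \<and> star_eq H R G \<and> (\<forall>x\<in>pverts H. (x, x) \<in> R)"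

definition R_coretract :: "'a pair_pre_digraph \<Rightarrow> 'a pair_pre_digraph \<Rightarrow> bool" where
  "R_coretract H G \<longleftrightarrow> (\<exists>R. R_coretraction H G R)"

definition R_cocore :: "'a pair_pre_digraph \<Rightarrow> 'a pair_pre_digraph \<Rightarrow> bool" where
  "R_cocore H G \<longleftrightarrow>
     R_coretract H G \<and>
     \<not> (\<exists>K. induced_subgraph (with_proj K) (with_proj H) \<and> K \<noteq> H \<and> R_coretract K H)"

end

(* Write N(v) for the neighbourhood of v in G. An induced subgraph of G is an R-coretract exactly
   if every N(v) is the union of a nonempty family of neighbourhoods of its vertices. Minimality
   of a cocore says that no vertex s of it has an N(s) that is such a union over the remaining
   vertices. Expanding N(s), for s in one cocore, over the other cocore and then back over the
   first one therefore meets s again, which squeezes some N(t) with t in the other cocore between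
   N(s) and N(s). Matching the vertices with equal neighbourhoods is an isomorphism. *)
theory Submission
  imports Defs
begin

text \<open>Below, neighbourhoods are taken in the ambient graph even for vertices of a subgraph, so
  that vertices of two different subgraphs can be compared through them.\<close>

definition nbhd :: "'a pair_pre_digraph \<Rightarrow> 'a \<Rightarrow> 'a set" where
  "nbhd G v = parcs G `` {v}"

lemma mem_nbhd [simp]: "u \<in> nbhd G v \<longleftrightarrow> (v, u) \<in> parcs G"
  by (simp add: nbhd_def)

lemma induced_subgraph_with_proj_iff:
  "induced_subgraph (with_proj H) (with_proj G) \<longleftrightarrow>
     wf_digraph (with_proj G) \<and> pverts H \<subseteq> pverts G \<and>
     parcs H = parcs G \<inter> pverts H \<times> pverts H"
proof -
  have "{e \<in> parcs G. fst e \<in> pverts H \<and> snd e \<in> pverts H} = parcs G \<inter> pverts H \<times> pverts H"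
    by auto
  moreover have "wf_digraph (with_proj H)" if "parcs H = parcs G \<inter> pverts H \<times> pverts H"
    using that by (simp add: wf_digraph_def)
  ultimately show ?thesis
    unfolding induced_subgraph_def subgraph_def compatible_def with_proj_simps by blast
qed

lemma R_coretract_induced:
  assumes "R_coretract H G"
  shows "pverts H \<subseteq> pverts G" and "parcs H = parcs G \<inter> pverts H \<times> pverts H"
  using assms unfolding R_coretract_def R_coretraction_def induced_subgraph_with_proj_iff
  by blast+

lemma R_cocore_imp_R_coretract: "R_cocore H G \<Longrightarrow> R_coretract H G"
  by (simp add: R_cocore_def)

text \<open>The family consists of all \<open>x\<close> that the coretraction \<open>R\<close>
  relates to \<open>v\<close>. Since \<open>R\<close> is reflexive on \<open>H\<close>, an arc of
  \<open>G\<close> can be pulled back at one endpoint only.\<close>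

lemma R_coretractD:
  assumes "sym (parcs G)" and "R_coretract H G" and "v \<in> pverts G"
  obtains P where "P \<subseteq> pverts H" and "P \<noteq> {}" and "nbhd G v = (\<Union>x\<in>P. nbhd G x)"
proof -
  obtain R where R: "R_coretraction H G R"
    using assms(2) by (auto simp: R_coretract_def)
  then have HG: "pverts H \<subseteq> pverts G" "parcs H = parcs G \<inter> pverts H \<times> pverts H"
    and dom: "R \<subseteq> pverts H \<times> pverts G" "\<And>u. u \<in> pverts G \<Longrightarrow> \<exists>x. (x, u) \<in> R"
    and star: "star H (pverts G) R = G"
    and refl: "\<And>x. x \<in> pverts H \<Longrightarrow> (x, x) \<in> R"
    by (auto simp: R_coretraction_def induced_subgraph_with_proj_iff star_eq_def full_image_def)
  have arcs_iff: "(a, b) \<in> parcs G \<longleftrightarrow>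
      a \<in> pverts G \<and> b \<in> pverts G \<and> (\<exists>x y. (x, y) \<in> parcs H \<and> (x, a) \<in> R \<and> (y, b) \<in> R)" for a b
    by (subst star [symmetric]) (simp add: star_def)
  have symD: "(b, a) \<in> parcs G" if "(a, b) \<in> parcs G" for a b
    using assms(1) that by (rule symD)
  \<comment> \<open>The pair \<open>(x, x)\<close> of \<open>R\<close> keeps one endpoint fixed
    while \<open>R\<close> moves \<open>y\<close> to \<open>b\<close>.\<close>
  have adj_source: "(b, x) \<in> parcs G" if "(x, y) \<in> parcs H" "(y, b) \<in> R" for x y b
    using that HG dom refl arcs_iff[of x b] symD by blast
  have union: "(a, b) \<in> parcs G \<longleftrightarrow> (\<exists>x. (x, a) \<in> R \<and> (x, b) \<in> parcs G)" for a b
  proof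
    assume "(a, b) \<in> parcs G"
    then show "\<exists>x. (x, a) \<in> R \<and> (x, b) \<in> parcs G"
      using arcs_iff[of a b] adj_source symD by blast
  next
    assume "\<exists>x. (x, a) \<in> R \<and> (x, b) \<in> parcs G"
    then obtain x where x: "(x, a) \<in> R" "(x, b) \<in> parcs G" by blast
    \<comment> \<open>Pulling \<open>(x, b)\<close> back as well gives a \<open>y\<close> related to
      \<open>b\<close>, and moving \<open>z\<close> to \<open>x\<close> makes \<open>y\<close>
      adjacent to \<open>x\<close>. So \<open>(x, y)\<close> is an arc of \<open>H\<close>, and
      \<open>R\<close> carries it to \<open>(a, b)\<close>.\<close>
    then obtain z y where zy: "(z, y) \<in> parcs H" "(z, x) \<in> R" "(y, b) \<in> R"
      using arcs_iff[of x b] by blast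
    have "(y, x) \<in> parcs H"
      using adj_source[of y z x] symD zy HG x(1) dom(1) by blast
    then show "(a, b) \<in> parcs G"
      using adj_source[of y x a] symD arcs_iff[of a b] x(1) zy(3) HG dom(1) by blast
  qed
  show thesis
  proof (rule that)
    show "{x. (x, v) \<in> R} \<subseteq> pverts H" using dom(1) by blast
    show "{x. (x, v) \<in> R} \<noteq> {}" using dom(2)[OF assms(3)] by simp
    show "nbhd G v = (\<Union>x\<in>{x. (x, v) \<in> R}. nbhd G x)"
      by (rule set_eqI) (simp add: union[of v])
  qed
qed

text \<open>Otherwise \<open>s\<close> could be deleted: the vertices of \<open>P\<close> stand in
  for it, and the rest of \<open>H\<close> would be a proper R-coretract of \<open>H\<close>,
  against minimality.\<close>

lemma R_cocore_irredundant:
  assumes "sym (parcs G)" and "R_cocore H G" and "s \<in> pverts H"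
    and "P \<subseteq> pverts H" and "P \<noteq> {}" and "nbhd G s = (\<Union>x\<in>P. nbhd G x)"
  shows "s \<in> P"
proof (rule ccontr)
  assume "s \<notin> P"
  have EH: "parcs H = parcs G \<inter> pverts H \<times> pverts H"
    using R_coretract_induced(2)[OF R_cocore_imp_R_coretract[OF assms(2)]] .
  have symH: "(b, a) \<in> parcs H" if "(a, b) \<in> parcs H" for a b
    using that symD[OF assms(1)] EH by blast
  have s_arc: "(s, b) \<in> parcs H \<longleftrightarrow> (\<exists>x\<in>P. (x, b) \<in> parcs H)" for b
  proof -
    have "(s, b) \<in> parcs G \<longleftrightarrow> (\<exists>x\<in>P. (x, b) \<in> parcs G)"
      using assms(6) by (auto simp: set_eq_iff)
    then show ?thesis using EH assms(3,4) by blast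
  qed
  define K where
    "K = \<lparr>pverts = pverts H - {s}, parcs = parcs H \<inter> (pverts H - {s}) \<times> (pverts H - {s})\<rparr>"
  \<comment> \<open>The surviving vertices are related to themselves, as a coretraction demands. The
    deleted \<open>s\<close> is restored as a joint image of all of \<open>P\<close>.\<close>
  define R where "R = Id_on (pverts H - {s}) \<union> P \<times> {s}"
  have "wf_digraph (with_proj H)"
    using EH by (auto simp: wf_digraph_def)
  then have ind: "induced_subgraph (with_proj K) (with_proj H)"
    by (auto simp: induced_subgraph_with_proj_iff K_def)
  have "s \<notin> pverts K" by (simp add: K_def)
  then have "K \<noteq> H" using assms(3) by blast
  have R_arc: "(a, b) \<in> parcs H \<longleftrightarrow> (\<exists>x. (x, a) \<in> R \<and> (x, b) \<in> parcs H)"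
    if "a \<in> pverts H" for a b
    using that s_arc[of b] by (cases "a = s") (auto simp: R_def)
  have R_sub: "x \<in> pverts H - {s}" if "(x, a) \<in> R" for x a
    using that \<open>s \<notin> P\<close> assms(4) by (auto simp: R_def)
  have R_K_arc: "(x, y) \<in> parcs K \<longleftrightarrow> (x, y) \<in> parcs H" if "(x, a) \<in> R" "(y, b) \<in> R" for x y a b
    using R_sub[OF that(1)] R_sub[OF that(2)] by (simp add: K_def)
  \<comment> \<open>The endpoints are expanded through \<open>R\<close> one after the other,
    reversing the arc in between. No source of \<open>R\<close> is \<open>s\<close>, so the
    resulting arcs lie in \<open>K\<close>.\<close>
  have "(a, b) \<in> parcs H \<longleftrightarrow>
      a \<in> pverts H \<and> b \<in> pverts H \<and> (\<exists>x y. (x, y) \<in> parcs K \<and> (x, a) \<in> R \<and> (y, b) \<in> R)" for a b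
  proof (cases "a \<in> pverts H \<and> b \<in> pverts H")
    case True
    then have "(a, b) \<in> parcs H \<longleftrightarrow> (\<exists>x. (x, a) \<in> R \<and> (b, x) \<in> parcs H)"
      using R_arc[of a b] symH by blast
    also have "\<dots> \<longleftrightarrow> (\<exists>x y. (x, y) \<in> parcs H \<and> (x, a) \<in> R \<and> (y, b) \<in> R)"
      using True R_arc[of b] symH by blast
    finally show ?thesis
      using True R_K_arc by blast
  next
    case False
    then show ?thesis using EH by blast
  qed
  then have "star K (pverts H) R = H"
    by (intro pair_pre_digraph.equality) (auto simp: star_def)
  moreover have "full_image (pverts K) (pverts H) R"
    using assms(3,4,5) \<open>s \<notin> P\<close> by (auto simp: full_image_def K_def R_def)
  ultimately have "R_coretraction K H R"
    using ind by (auto simp: R_coretraction_def star_eq_def K_def R_def)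
  then show False
    using assms(2) ind \<open>K \<noteq> H\<close> unfolding R_cocore_def R_coretract_def by blast
qed

text \<open>A twin \<open>t\<close> of \<open>s\<close> would express the neighbourhood of
  \<open>s\<close> by the one-element family \<open>{t}\<close>.\<close>

lemma R_cocore_inj_nbhd:
  assumes "sym (parcs G)" and "R_cocore H G"
  shows "inj_on (nbhd G) (pverts H)"
proof (rule inj_onI)
  fix s t assume "s \<in> pverts H" "t \<in> pverts H" "nbhd G s = nbhd G t"
  then show "s = t"
    using R_cocore_irredundant[OF assms, of s "{t}"] by simp
qed

text \<open>Applied in both directions to two cocores, this shows that they realise the same set of
  neighbourhoods.\<close>

lemma R_cocore_nbhd_subset:
  assumes "sym (parcs G)" and "R_cocore H G" and "R_coretract K G"
  shows "nbhd G ` pverts H \<subseteq> nbhd G ` pverts K"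
proof (rule image_subsetI)
  fix s assume s: "s \<in> pverts H"
  have H: "R_coretract H G" using assms(2) by (rule R_cocore_imp_R_coretract)
  have VH: "pverts H \<subseteq> pverts G" and VK: "pverts K \<subseteq> pverts G"
    using R_coretract_induced(1) H assms(3) by blast+
  obtain Q where Q: "Q \<subseteq> pverts K" "Q \<noteq> {}" "nbhd G s = (\<Union>t\<in>Q. nbhd G t)"
    using R_coretractD[OF assms(1,3)] s VH by blast
  have "\<exists>P. P \<subseteq> pverts H \<and> P \<noteq> {} \<and> nbhd G t = (\<Union>x\<in>P. nbhd G x)" if "t \<in> Q" for t
  proof -
    have "t \<in> pverts G" using that Q(1) VK by blast
    then show ?thesis by (rule R_coretractD[OF assms(1) H]) blast
  qed
  then obtain P where P: "\<And>t. t \<in> Q \<Longrightarrow> P t \<subseteq> pverts H \<and> P t \<noteq> {}"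
      "\<And>t. t \<in> Q \<Longrightarrow> nbhd G t = (\<Union>x\<in>P t. nbhd G x)"
    by metis
  have "s \<in> (\<Union>t\<in>Q. P t)"
  proof (rule R_cocore_irredundant[OF assms(1,2) s])
    show "(\<Union>t\<in>Q. P t) \<subseteq> pverts H" using P(1) by blast
    show "(\<Union>t\<in>Q. P t) \<noteq> {}" using P(1) Q(2) by blast
    show "nbhd G s = (\<Union>x\<in>(\<Union>t\<in>Q. P t). nbhd G x)" using Q(3) P(2) by simp
  qed
  then obtain t where t: "t \<in> Q" "s \<in> P t" by blast
  \<comment> \<open>Here \<open>s\<close> occurs in the expansion of \<open>t\<close>, and
    \<open>t\<close> in that of \<open>s\<close>, which gives both inclusions.\<close>
  then have "nbhd G s = nbhd G t" using Q(3) P(2)[OF t(1)] by blast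
  then show "nbhd G s \<in> nbhd G ` pverts K" using t(1) Q(1) by blast
qed

lemma digraph_iso_with_projI:
  assumes "wf_digraph (with_proj H)" and "wf_digraph (with_proj K)"
    and bij: "bij_betw f (pverts H) (pverts K)"
    and arcs: "\<And>u v. u \<in> pverts H \<Longrightarrow> v \<in> pverts H \<Longrightarrow>
                 (u, v) \<in> parcs H \<longleftrightarrow> (f u, f v) \<in> parcs K"
  shows "digraph_iso (with_proj H) (with_proj K)"
proof -
  define hom where
    \<comment> \<open>Arcs are pairs of endpoints, so the vertex map dictates the arc map.\<close>
    "hom = \<lparr>iso_verts = f, iso_arcs = map_prod f f, iso_head = snd, iso_tail = fst\<rparr>"
  have EH: "parcs H \<subseteq> pverts H \<times> pverts H" and EK: "parcs K \<subseteq> pverts K \<times> pverts K"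
    using assms(1,2) by (auto simp: wf_digraph_def)
  have inj: "inj_on f (pverts H)" and img: "f ` pverts H = pverts K"
    using bij by (auto simp: bij_betw_def)
  have "inj_on (map_prod f f) (parcs H)"
    using map_prod_inj_on[OF inj inj] EH by (rule inj_on_subset)
  then have "pre_digraph.digraph_isomorphism (with_proj H) hom"
    using assms(1) inj EH by (auto simp: pre_digraph.digraph_isomorphism_def hom_def)
  moreover have "map_prod f f ` parcs H = parcs K"
  proof
    show "map_prod f f ` parcs H \<subseteq> parcs K" using EH arcs by auto
    show "parcs K \<subseteq> map_prod f f ` parcs H"
    proof
      fix e assume "e \<in> parcs K"
      moreover from this obtain u v where "u \<in> pverts H" "v \<in> pverts H" "e = (f u, f v)"
        using EK img by blast
      ultimately show "e \<in> map_prod f f ` parcs H" using arcs by force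
    qed
  qed
  then have "with_proj K = app_iso hom (with_proj H)"
    using img by (simp add: app_iso_def hom_def with_proj_def)
  ultimately show ?thesis by (auto simp: digraph_iso_def)
qed

theorem proposition5p16:
  fixes G H\<^sub>1 H\<^sub>2 :: "'a pair_pre_digraph"
  assumes "pair_graph G"
    and "R_cocore H\<^sub>1 G"
    and "R_cocore H\<^sub>2 G"
  shows "digraph_iso (with_proj H\<^sub>1) (with_proj H\<^sub>2)"
proof -
  interpret pair_graph G by fact
  have sym: "sym (parcs G)"
    using sym_arcs by (simp add: symmetric_def)
  have retr: "R_coretract H\<^sub>1 G" "R_coretract H\<^sub>2 G"
    using assms(2,3) by (auto intro: R_cocore_imp_R_coretract)
  have E: "parcs H\<^sub>1 = parcs G \<inter> pverts H\<^sub>1 \<times> pverts H\<^sub>1"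
      "parcs H\<^sub>2 = parcs G \<inter> pverts H\<^sub>2 \<times> pverts H\<^sub>2"
    using retr[THEN R_coretract_induced(2)] .
  have img: "nbhd G ` pverts H\<^sub>1 = nbhd G ` pverts H\<^sub>2"
    using R_cocore_nbhd_subset[OF sym] assms(2,3) retr by blast
  \<comment> \<open>This sends \<open>u\<close> to the only vertex of the second cocore with the
    same neighbourhood; it exists by \<open>img\<close> and is unique by injectivity.\<close>
  define f where "f = inv_into (pverts H\<^sub>2) (nbhd G) \<circ> nbhd G"
  have bij: "bij_betw f (pverts H\<^sub>1) (pverts H\<^sub>2)"
    unfolding f_def
  proof (rule bij_betw_trans)
    show "bij_betw (nbhd G) (pverts H\<^sub>1) (nbhd G ` pverts H\<^sub>2)"
      using R_cocore_inj_nbhd[OF sym assms(2)] img by (simp add: bij_betw_def)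
    show "bij_betw (inv_into (pverts H\<^sub>2) (nbhd G)) (nbhd G ` pverts H\<^sub>2) (pverts H\<^sub>2)"
      using R_cocore_inj_nbhd[OF sym assms(3)]
      by (intro bij_betw_inv_into) (simp add: bij_betw_def)
  qed
  have nbhd_f: "nbhd G (f u) = nbhd G u" if "u \<in> pverts H\<^sub>1" for u
  proof -
    have "nbhd G u \<in> nbhd G ` pverts H\<^sub>2" using that img by blast
    then show ?thesis by (simp add: f_def f_inv_into_f)
  qed
  have f_arc: "(f u, v) \<in> parcs G \<longleftrightarrow> (u, v) \<in> parcs G" if "u \<in> pverts H\<^sub>1" for u v
    using nbhd_f[OF that] by (metis mem_nbhd)
  show ?thesis
  proof (rule digraph_iso_with_projI[OF _ _ bij])
    show "wf_digraph (with_proj H\<^sub>1)" "wf_digraph (with_proj H\<^sub>2)"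
      using E by (auto simp: wf_digraph_def)
    fix u v assume uv: "u \<in> pverts H\<^sub>1" "v \<in> pverts H\<^sub>1"
    \<comment> \<open>The fact \<open>f_arc\<close> replaces a first endpoint only, so it is used
      once on the arc and once on its reverse.\<close>
    have "(u, v) \<in> parcs G \<longleftrightarrow> (f u, f v) \<in> parcs G"
      using f_arc uv sym by (meson symD)
    moreover have "f u \<in> pverts H\<^sub>2" "f v \<in> pverts H\<^sub>2"
      using bij uv by (auto simp: bij_betw_def)
    ultimately show "(u, v) \<in> parcs H\<^sub>1 \<longleftrightarrow> (f u, f v) \<in> parcs H\<^sub>2"
      using E uv by blast
  qed
qed

end
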